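(* Let $\alpha, \varepsilon \in\mathbb{R}$ be fixed with $\alpha\leq 0$ and $\varepsilon \geq 0$. Suppose that the function $f:]0,1[\rightarrow\mathbb{R}$ satisfies the inequality $$\left|f(x)+(1-x)^{\alpha}f\left(\frac{y}{1-x}\right)-f(y)-(1-y)^{\alpha}f\left(\frac{x}{1-y}\right)\right| \leq \varepsilon$$ for all $(x, y)\in D^{\circ}$. Then: (i) in case $\alpha<0$, there exist $a, b\in\mathbb{R}$ such that $$\left|f(x)-\left[ax^{\alpha}+b(1-x)^{\alpha}-b\right]\right| \leq 15 \varepsilon \quad \text{for all } x\in ]0,1[;$$ (ii) in case $\alpha=0$, there exist a logarithmic function $l: ]0,1[\rightarrow\mathbb{R}$ and $c\in \mathbb{R}$ such that $$\left|f(x)-\left[l(1-x)+c\right]\right|\leq 63 \varepsilon \quad \text{for all } x\in ]0,1[.$$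
   Context: $]0,1[$ denotes the open unit interval. $D^{\circ}=\{(x, y)\in\mathbb{R}^{2} : x, y, x+y\in ]0,1[\}$. A function $l:]0,1[\rightarrow\mathbb{R}$ is called logarithmic if $l(xy)=l(x)+l(y)$ for all $x,y\in ]0,1[$ (no regularity is assumed). *)

theory Defs
  imports Complex_Main
begin

text \<open>
  Functions \<open>]0,1[ \<rightarrow> \<real>\<close> are modelled by total functions on \<^typ>\<open>real\<close>, whose values are only
  constrained (and only evaluated) on \<open>{0<..<1}\<close>.
\<close>

definition D_open :: "(real \<times> real) set" where
  "D_open = {(x, y). x \<in> {0<..<1} \<and> y \<in> {0<..<1} \<and> x + y \<in> {0<..<1}}"

definition logarithmic :: "(real \<Rightarrow> real) \<Rightarrow> bool" where
  "logarithmic l \<longleftrightarrow> (\<forall>x\<in>{0<..<1}. \<forall>y\<in>{0<..<1}. l (x * y) = l x + l y)"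

end

theory Submission
  imports Defs
begin

text \<open>
  Put \<open>F u v = (u + v) powr \<alpha> * f (v / (u + v))\<close> for \<open>u, v > 0\<close>. By homogeneity the hypothesis
  becomes \<open>\<bar>F z y + F (z + y) x - F z x - F (z + x) y\<bar> \<le> \<epsilon> * (x + y + z) powr \<alpha>\<close>.
  Adding the three cyclic instances leaves only the antisymmetric part \<open>A u v = F u v - F v u\<close>:
  \<open>\<bar>A x y + A y z + A z x\<bar> \<le> 3 * \<epsilon> * (x + y + z) powr \<alpha>\<close>.
  If \<open>\<alpha> < 0\<close>, letting one variable tend to infinity forces \<open>A u v = c * (v powr \<alpha> - u powr \<alpha>)\<close>
  exactly; if \<open>\<alpha> = 0\<close>, then \<open>\<lambda>t. A t 1\<close> is approximately logarithmic and Hyers' theorem applies.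
  Subtracting a suitable exact solution makes \<open>F\<close> (almost) symmetric, hence an approximate
  2-cocycle on the additive semigroup of positive reals. Comparing the bracketings \<open>(u+v)+(u+v)\<close>
  and \<open>(u+u)+(v+v)\<close> gives \<open>F (2u) (2v) \<approx> 2 F u v - F u u - F v v + F (u+v) (u+v)\<close>, and
  since \<open>F (2u) (2v) = 2 powr \<alpha> * F u v\<close> and \<open>F u u = u powr \<alpha> * F 1 1\<close>, this determines \<open>F\<close>
  without any regularity assumption.
\<close>

section \<open>Homogeneous form of the inequality\<close>

definition homogeneous_extension :: "real \<Rightarrow> (real \<Rightarrow> real) \<Rightarrow> real \<Rightarrow> real \<Rightarrow> real" where
  "homogeneous_extension \<alpha> f u v = (u + v) powr \<alpha> * f (v / (u + v))"

lemma homogeneous_extension_scale: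
  assumes "t > 0" "u > 0" "v > 0"
  shows "homogeneous_extension \<alpha> f (t * u) (t * v) = t powr \<alpha> * homogeneous_extension \<alpha> f u v"
proof -
  have "t * u + t * v = t * (u + v)" by (simp add: algebra_simps)
  with assms show ?thesis
    by (simp add: homogeneous_extension_def powr_mult)
qed

text \<open>This is the hypothesis at \<open>(x / s, y / s)\<close> with
  \<open>s = x + y + z\<close>, multiplied by \<open>s powr \<alpha>\<close>: there
  \<open>1 - x / s = (z + y) / s\<close>, so the inner quotients become \<open>y / (z + y)\<close>
  and \<open>x / (z + x)\<close>.\<close>

lemma homogeneous_extension_defect:
  assumes hyp: "\<forall>(x, y)\<in>D_open.
      \<bar>f x + (1 - x) powr \<alpha> * f (y / (1 - x)) - f y - (1 - y) powr \<alpha> * f (x / (1 - y))\<bar> \<le> \<epsilon>"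
    and pos: "x > 0" "y > 0" "z > 0"
  defines "F \<equiv> homogeneous_extension \<alpha> f"
  shows "\<bar>F z y + F (z + y) x - F z x - F (z + x) y\<bar> \<le> \<epsilon> * (x + y + z) powr \<alpha>"
proof -
  define s where "s = x + y + z"
  have s: "s > 0" using pos by (simp add: s_def)
  have "(x / s, y / s) \<in> D_open"
    unfolding D_open_def using pos s by (simp add: s_def flip: add_divide_distrib)
  with hyp have *: "\<bar>f (x/s) + (1 - x/s) powr \<alpha> * f ((y/s) / (1 - x/s))
      - f (y/s) - (1 - y/s) powr \<alpha> * f ((x/s) / (1 - y/s))\<bar> \<le> \<epsilon>" (is "\<bar>?D\<bar> \<le> _")
    by blast
  have r: "1 - x/s = (z + y) / s" "1 - y/s = (z + x) / s"
    using s by (simp_all add: s_def field_simps)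
  have "s powr \<alpha> * ?D = F z y + F (z + y) x - F z x - F (z + x) y"
  proof -
    have q: "s powr \<alpha> * (w / s) powr \<alpha> = w powr \<alpha>" if "w > 0" for w
      using s that by (simp add: powr_divide)
    have q': "s powr \<alpha> * ((w / s) powr \<alpha> * d) = w powr \<alpha> * d" if "w > 0" for w d
      by (metis q[OF that] mult.assoc)
    have e: "z + y + x = s" "z + x + y = s" by (simp_all add: s_def)
    have d: "(y/s) / ((z + y) / s) = y / (z + y)" "(x/s) / ((z + x) / s) = x / (z + x)"
      using s by simp_all
    have zy: "z + y > 0" "z + x > 0" using pos by simp_all
    show ?thesis
      unfolding r F_def homogeneous_extension_def e d
      by (simp only: ring_distribs q'[OF zy(1)] q'[OF zy(2)])
  qed
  moreover have "\<bar>s powr \<alpha> * ?D\<bar> \<le> s powr \<alpha> * \<epsilon>"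
    unfolding abs_mult using * by (simp add: mult_left_mono)
  ultimately show ?thesis by (simp add: s_def mult.commute)
qed

section \<open>The antisymmetric part\<close>

text \<open>In the cyclic sum each nested term such as \<open>F (z + y) x\<close> occurs once with
  each sign and cancels.\<close>

lemma almost_cyclic_antisymmetric_part:
  fixes F :: "real \<Rightarrow> real \<Rightarrow> real"
  assumes defect: "\<And>x y z. x > 0 \<Longrightarrow> y > 0 \<Longrightarrow> z > 0 \<Longrightarrow>
      \<bar>F z y + F (z + y) x - F z x - F (z + x) y\<bar> \<le> e (x + y + z)"
    and pos: "x > 0" "y > 0" "z > 0"
  shows "\<bar>(F x y - F y x) + (F y z - F z y) + (F z x - F x z)\<bar> \<le> 3 * e (x + y + z)"
  using defect[of x y z] defect[of y z x] defect[of z x y] pos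
  by (simp add: add_ac)

text \<open>The bound decays when a variable grows, because \<alpha> < 0. Expanding
  \<open>A (x * y) 1\<close> in two ways and letting \<open>y\<close> tend to infinity turns the
  approximate relation into an exact one.\<close>

lemma antisymmetric_part_powr:
  fixes A :: "real \<Rightarrow> real \<Rightarrow> real"
  assumes "\<alpha> < 0"
    and anti: "\<And>u v. A u v = - A v u"
    and homog: "\<And>t u v. t > 0 \<Longrightarrow> u > 0 \<Longrightarrow> v > 0 \<Longrightarrow> A (t * u) (t * v) = t powr \<alpha> * A u v"
    and cyc: "\<And>x y z. x > 0 \<Longrightarrow> y > 0 \<Longrightarrow> z > 0 \<Longrightarrow>
      \<bar>A x y + A y z + A z x\<bar> \<le> \<delta> * (x + y + z) powr \<alpha>"
  obtains c where "\<And>u v. u > 0 \<Longrightarrow> v > 0 \<Longrightarrow> A u v = c * (v powr \<alpha> - u powr \<alpha>)"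
proof -
  define \<psi> where "\<psi> t = A t 1" for t
  have "0 \<le> \<delta> * 3 powr \<alpha>" using cyc[of 1 1 1] by simp
  then have "\<delta> \<ge> 0" by (simp add: zero_le_mult_iff)
  \<comment> \<open>Any positive lower bound \<open>w\<close> of the total argument is allowed;
    \<open>w = y\<close> and \<open>w = x * y\<close> will give errors that vanish as
    \<open>y\<close> grows.\<close>
  have mult: "\<bar>y powr \<alpha> * \<psi> x + \<psi> y - \<psi> (x * y)\<bar> \<le> \<delta> * w powr \<alpha>"
    if "x > 0" "y > 0" "w > 0" "w \<le> 1 + y + x * y" for x y w
  proof -
    have "A (x * y) y = y powr \<alpha> * \<psi> x"
      using homog[of y x 1] that by (simp add: \<psi>_def mult.commute)
    then have "\<bar>y powr \<alpha> * \<psi> x + \<psi> y - \<psi> (x * y)\<bar> \<le> \<delta> * (x * y + y + 1) powr \<alpha>"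
      using cyc[of "x * y" y 1] that anti[of 1 "x * y"] by (simp add: \<psi>_def)
    also have "\<dots> \<le> \<delta> * w powr \<alpha>"
      using that \<open>\<alpha> < 0\<close> \<open>\<delta> \<ge> 0\<close> by (intro mult_left_mono powr_mono2') auto
    finally show ?thesis .
  qed
  have D: "\<bar>\<psi> x * (y powr \<alpha> - 1) - \<psi> y * (x powr \<alpha> - 1)\<bar> \<le> \<delta> * (1 + x powr \<alpha>) * y powr \<alpha>"
    if "x > 0" "y > 0" for x y
    using mult[of x y y] mult[of y x "x * y"] that by (simp add: algebra_simps powr_mult)
  have \<psi>: "(2 powr \<alpha> - 1) * \<psi> x = (x powr \<alpha> - 1) * \<psi> 2" if "x > 0" for x
  proof -
    \<comment> \<open>Eliminating \<open>\<psi> y\<close> between \<open>D\<close> at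
      \<open>x\<close> and \<open>D\<close> at 2 leaves \<open>K\<close> times a factor tending to
      -1. The point 2 serves as a reference because \<open>2 powr \<alpha>\<close> differs from
      1.\<close>
    define K where "K = (2 powr \<alpha> - 1) * \<psi> x - (x powr \<alpha> - 1) * \<psi> 2"
    define C where "C = \<bar>2 powr \<alpha> - 1\<bar> * (\<delta> * (1 + x powr \<alpha>))
                        + \<bar>x powr \<alpha> - 1\<bar> * (\<delta> * (1 + 2 powr \<alpha>))"
    have bd: "\<bar>(y powr \<alpha> - 1) * K\<bar> \<le> C * y powr \<alpha>" if "y > 0" for y
    proof -
      have "(y powr \<alpha> - 1) * K = (2 powr \<alpha> - 1) * (\<psi> x * (y powr \<alpha> - 1) - \<psi> y * (x powr \<alpha> - 1))
          - (x powr \<alpha> - 1) * (\<psi> 2 * (y powr \<alpha> - 1) - \<psi> y * (2 powr \<alpha> - 1))"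
        by (simp add: K_def algebra_simps)
      also have "\<bar>\<dots>\<bar> \<le> \<bar>2 powr \<alpha> - 1\<bar> * (\<delta> * (1 + x powr \<alpha>) * y powr \<alpha>)
                        + \<bar>x powr \<alpha> - 1\<bar> * (\<delta> * (1 + 2 powr \<alpha>) * y powr \<alpha>)"
        by (rule order_trans[OF abs_triangle_ineq4], unfold abs_mult)
           (intro add_mono mult_left_mono D that \<open>x > 0\<close>, auto)
      finally show ?thesis by (simp add: C_def algebra_simps)
    qed
    have lim: "((\<lambda>y::real. y powr \<alpha>) \<longlongrightarrow> 0) at_top"
      using \<open>\<alpha> < 0\<close> by (rule tendsto_neg_powr) (rule filterlim_ident)
    have "\<bar>(0 - 1) * K\<bar> \<le> C * 0"
    proof (rule tendsto_le[OF trivial_limit_at_top_linorder])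
      show "((\<lambda>y. \<bar>(y powr \<alpha> - 1) * K\<bar>) \<longlongrightarrow> \<bar>(0 - 1) * K\<bar>) at_top"
        by (intro tendsto_intros lim)
      show "((\<lambda>y. C * y powr \<alpha>) \<longlongrightarrow> C * 0) at_top"
        by (intro tendsto_intros lim)
      show "eventually (\<lambda>y. \<bar>(y powr \<alpha> - 1) * K\<bar> \<le> C * y powr \<alpha>) at_top"
        using eventually_gt_at_top[of 0] by eventually_elim (rule bd)
    qed
    then show ?thesis by (simp add: K_def)
  qed
  define c where "c = \<psi> 2 / (1 - 2 powr \<alpha>)"
  have "2 powr \<alpha> < 1" using \<open>\<alpha> < 0\<close> by (simp add: powr_less_one)
  show ?thesis
  proof (rule that[of c])
    fix u v :: real assume "u > 0" "v > 0"
    then have "A u v = v powr \<alpha> * \<psi> (u / v)"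
      using homog[of v "u / v" 1] by (simp add: \<psi>_def)
    also have "\<psi> (u / v) = c * (1 - (u / v) powr \<alpha>)"
    proof -
      have "(1 - 2 powr \<alpha>) * \<psi> (u / v) = \<psi> 2 * (1 - (u / v) powr \<alpha>)"
        using \<psi>[of "u / v"] \<open>u > 0\<close> \<open>v > 0\<close> by (simp add: algebra_simps)
      then show ?thesis
        using \<open>2 powr \<alpha> < 1\<close> \<open>\<alpha> < 0\<close> by (simp add: c_def eq_divide_eq mult.commute)
    qed
    finally show "A u v = c * (v powr \<alpha> - u powr \<alpha>)"
      using \<open>u > 0\<close> \<open>v > 0\<close> by (simp add: powr_divide algebra_simps)
  qed
qed

section \<open>Hyers' theorem, additive and logarithmic\<close>

text \<open>Direct method: rescaled doublings of the argument converge geometrically, and in the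
  limit the additivity defect, divided by \<open>2 ^ n\<close>, disappears.\<close>

lemma Hyers_stability:
  fixes h :: "'a::real_vector \<Rightarrow> 'b::banach"
  assumes approx: "\<And>s t. norm (h (s + t) - h s - h t) \<le> \<delta>"
  obtains L where "\<And>s t. L (s + t) = L s + L t" and "\<And>s. norm (h s - L s) \<le> \<delta>"
proof -
  define q where "q n s = (1 / 2 ^ n) *\<^sub>R h ((2 ^ n) *\<^sub>R s)" for n :: nat and s
  have step: "norm (q (Suc n) s - q n s) \<le> \<delta> * (1/2) ^ Suc n" for n s
  proof -
    define w where "w = (2 ^ n) *\<^sub>R s"
    have "(2 ^ Suc n) *\<^sub>R s = w + w"
      by (simp add: w_def scaleR_2 flip: scaleR_scaleR)
    moreover have "(1 / 2 ^ n) *\<^sub>R h w = (1 / 2 ^ Suc n) *\<^sub>R (h w + h w)"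
      by (simp flip: scaleR_2)
    ultimately have "q (Suc n) s - q n s = (1/2) ^ Suc n *\<^sub>R (h (w + w) - h w - h w)"
      by (simp add: q_def power_divide algebra_simps flip: w_def)
    moreover have "norm \<dots> \<le> (1/2) ^ Suc n * \<delta>"
      unfolding norm_scaleR using approx[of w w] by (intro mult_mono) auto
    ultimately show ?thesis by (simp add: mult.commute)
  qed
  have geo: "(\<lambda>n. \<delta> * (1/2) ^ Suc n) sums \<delta>"
    using sums_mult[OF power_half_series, of \<delta>] by simp
  \<comment> \<open>Writing the limit of \<open>q n s\<close> as a telescoping series lets the
    distance to \<open>h s\<close> be bounded by the geometric sum, which is exactly
    \<delta>.\<close>
  define L where "L s = h s + (\<Sum>n. q (Suc n) s - q n s)" for s
  have summ: "summable (\<lambda>n. norm (q (Suc n) s - q n s))" for s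
    by (rule summable_comparison_test'[OF sums_summable[OF geo], of 0]) (use step in auto)
  have lim: "(\<lambda>n. q n s) \<longlonglongrightarrow> L s" for s
  proof -
    have "(\<lambda>n. \<Sum>i<n. q (Suc i) s - q i s) \<longlonglongrightarrow> (\<Sum>n. q (Suc n) s - q n s)"
      by (rule summable_LIMSEQ[OF summable_norm_cancel[OF summ]])
    then have "(\<lambda>n. q n s - q 0 s) \<longlonglongrightarrow> (\<Sum>n. q (Suc n) s - q n s)"
      by (simp only: sum_lessThan_telescope[of "\<lambda>n. q n s"])
    from tendsto_add[OF tendsto_const[of "h s"] this] show ?thesis
      by (simp add: L_def q_def)
  qed
  show ?thesis
  proof (rule that[of L])
    fix s t
    have "(\<lambda>n. q n (s + t) - q n s - q n t) \<longlonglongrightarrow> L (s + t) - L s - L t"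
      by (intro tendsto_intros lim)
    moreover have "(\<lambda>n. q n (s + t) - q n s - q n t) \<longlonglongrightarrow> 0"
    proof (rule tendsto_0_le)
      show "\<forall>\<^sub>F n in sequentially. norm (q n (s + t) - q n s - q n t) \<le> norm ((1/2) ^ n :: real) * \<delta>"
      proof (rule always_eventually, rule allI)
        fix n
        have "q n (s + t) - q n s - q n t = (1/2) ^ n *\<^sub>R
            (h ((2 ^ n) *\<^sub>R s + (2 ^ n) *\<^sub>R t) - h ((2 ^ n) *\<^sub>R s) - h ((2 ^ n) *\<^sub>R t))"
          by (simp add: q_def power_divide scaleR_diff_right scaleR_add_right)
        moreover have "norm \<dots> \<le> (1/2) ^ n * \<delta>"
          unfolding norm_scaleR using approx by (intro mult_mono) auto
        ultimately show "norm (q n (s + t) - q n s - q n t) \<le> norm ((1/2) ^ n :: real) * \<delta>"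
          by simp
      qed
      show "(\<lambda>n. (1/2) ^ n :: real) \<longlonglongrightarrow> 0"
        by (rule LIMSEQ_power_zero) simp
    qed
    ultimately have "L (s + t) - L s - L t = 0"
      by (rule LIMSEQ_unique)
    then show "L (s + t) = L s + L t" by (simp add: algebra_simps)
  next
    fix s
    have "norm (h s - L s) = norm (\<Sum>n. q (Suc n) s - q n s)"
      by (simp add: L_def)
    also have "\<dots> \<le> (\<Sum>n. norm (q (Suc n) s - q n s))"
      by (rule summable_norm[OF summ])
    also have "\<dots> \<le> (\<Sum>n. \<delta> * (1/2) ^ Suc n)"
      by (rule suminf_le[OF step summ sums_summable[OF geo]])
    also have "\<dots> = \<delta>" by (rule sums_unique[OF geo, symmetric])
    finally show "norm (h s - L s) \<le> \<delta>" .
  qed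
qed

text \<open>The substitution \<open>x = exp s\<close> reduces this to the additive case.\<close>

lemma Hyers_stability_logarithmic:
  fixes \<psi> :: "real \<Rightarrow> 'b::banach"
  assumes approx: "\<And>x y. x > 0 \<Longrightarrow> y > 0 \<Longrightarrow> norm (\<psi> (x * y) - \<psi> x - \<psi> y) \<le> \<delta>"
  obtains L where "\<And>x y. x > 0 \<Longrightarrow> y > 0 \<Longrightarrow> L (x * y) = L x + L y"
    and "\<And>x. x > 0 \<Longrightarrow> norm (\<psi> x - L x) \<le> \<delta>"
proof -
  have "norm (\<psi> (exp (s + t)) - \<psi> (exp s) - \<psi> (exp t)) \<le> \<delta>" for s t :: real
    using approx[of "exp s" "exp t"] by (simp add: exp_add)
  then obtain M where M: "\<And>s t. M (s + t) = M s + M t" "\<And>s::real. norm (\<psi> (exp s) - M s) \<le> \<delta>"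
    by (rule Hyers_stability[of "\<lambda>s. \<psi> (exp s)" \<delta>]) blast+
  show ?thesis
  proof (rule that[of "\<lambda>x. M (ln x)"])
    fix x y :: real assume "x > 0" "y > 0"
    then show "M (ln (x * y)) = M (ln x) + M (ln y)"
      by (simp add: ln_mult M(1))
  next
    fix x :: real assume "x > 0"
    then show "norm (\<psi> x - M (ln x)) \<le> \<delta>"
      using M(2)[of "ln x"] by simp
  qed
qed

section \<open>Almost symmetric homogeneous cocycles\<close>

lemma almost_symmetric_cocycle_bound:
  fixes G :: "real \<Rightarrow> real \<Rightarrow> real"
  assumes "\<alpha> \<le> 0"
    and homog: "\<And>t u v. t > 0 \<Longrightarrow> u > 0 \<Longrightarrow> v > 0 \<Longrightarrow> G (t * u) (t * v) = t powr \<alpha> * G u v"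
    and defect: "\<And>x y z. x > 0 \<Longrightarrow> y > 0 \<Longrightarrow> z > 0 \<Longrightarrow>
      \<bar>G z y + G (z + y) x - G z x - G (z + x) y\<bar> \<le> \<epsilon> * (x + y + z) powr \<alpha>"
    and sym: "\<And>u v. u > 0 \<Longrightarrow> v > 0 \<Longrightarrow> \<bar>G u v - G v u\<bar> \<le> \<sigma> * (u + v) powr \<alpha>"
  obtains b where
    "\<And>u v. u > 0 \<Longrightarrow> v > 0 \<Longrightarrow> u + v = 1 \<Longrightarrow>
      \<bar>G u v - b * (u powr \<alpha> + v powr \<alpha> - 1)\<bar> \<le> 3 * \<epsilon> + 6 * \<sigma>"
proof -
  have "0 \<le> \<epsilon> * 3 powr \<alpha>" using defect[of 1 1 1] by simp
  then have "\<epsilon> \<ge> 0" by (simp add: zero_le_mult_iff)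
  have "0 \<le> \<sigma> * 2 powr \<alpha>" using sym[of 1 1] by simp
  then have "\<sigma> \<ge> 0" by (simp add: zero_le_mult_iff)
  \<comment> \<open>Working on \<open>u + v = 1\<close> keeps every total argument at least 1, so
    all powers in the error terms are at most 1.\<close>
  have small: "d * w powr \<alpha> \<le> d" if "d \<ge> 0" "w \<ge> 1" for d w
    using powr_mono[of \<alpha> 0 w] that \<open>\<alpha> \<le> 0\<close> by (simp add: mult_left_le)
  have sym1: "\<bar>G u v - G v u\<bar> \<le> \<sigma>" if "u > 0" "v > 0" "u + v \<ge> 1" for u v
    using sym[of u v] small[OF \<open>\<sigma> \<ge> 0\<close>, of "u + v"] that by linarith
  have assoc: "\<bar>G u v + G (u + v) w - G u (v + w) - G v w\<bar> \<le> \<epsilon> + 2 * \<sigma>"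
    if "u > 0" "v > 0" "w > 0" "u + v \<ge> 1" for u v w
    using defect[of w u v] small[OF \<open>\<epsilon> \<ge> 0\<close>, of "u + v + w"] sym1[of u v] sym1[of u "v + w"] that
    by (simp add: add_ac)
  have diag: "G u u = u powr \<alpha> * G 1 1" if "u > 0" for u
    using homog[of u 1 1] that by simp
  \<comment> \<open>Homogeneity turns the doubling relation below into
    \<open>(2 - 2 powr \<alpha>) * G u v\<close> being close to
    \<open>G 1 1 * (u powr \<alpha> + v powr \<alpha> - 1)\<close>. Since \<alpha> \<le> 0, the
    divisor is at least 1 and the error does not grow.\<close>
  define b where "b = G 1 1 / (2 - 2 powr \<alpha>)"
  have two: "2 - 2 powr \<alpha> \<ge> 1" using small[of 1 2] by simp
  show ?thesis
  proof (rule that[of b])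
    fix u v :: real assume uv: "u > 0" "v > 0" "u + v = 1"
    \<comment> \<open>The combination 1 + 2 - 3, corrected by the swaps 4 and 5. Two uses of
      \<open>assoc\<close> cost \<open>2 * \<epsilon> + 4 * \<sigma>\<close>, the direct use of
      \<open>defect\<close> costs \<epsilon>, and the swaps cost
      \<open>2 * \<sigma>\<close>.\<close>
    have "\<bar>2 * G u v + G (u + v) (u + v) - G u u - G v v - G (2 * u) (2 * v)\<bar> \<le> 3 * \<epsilon> + 6 * \<sigma>"
    proof -
      have e: "v + (u + v) = u + 2 * v" "v + v = 2 * v" "u + u = 2 * u" by simp_all
      have 1: "\<bar>G u v + G (u + v) (u + v) - G u (u + 2 * v) - G v (u + v)\<bar> \<le> \<epsilon> + 2 * \<sigma>"
        using assoc[of u v "u + v"] uv unfolding e by simp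
      have 2: "\<bar>G u v + G (u + v) v - G u (2 * v) - G v v\<bar> \<le> \<epsilon> + 2 * \<sigma>"
        using assoc[of u v v] uv unfolding e by simp
      have 3: "\<bar>G u u + G (2 * u) (2 * v) - G u (2 * v) - G (u + 2 * v) u\<bar> \<le> \<epsilon>"
        using defect[of "2 * v" u u] small[OF \<open>\<epsilon> \<ge> 0\<close>, of "2 * v + u + u"] uv unfolding e by linarith
      have 4: "\<bar>G v (u + v) - G (u + v) v\<bar> \<le> \<sigma>" using sym1[of v "u + v"] uv by simp
      have 5: "\<bar>G u (u + 2 * v) - G (u + 2 * v) u\<bar> \<le> \<sigma>" using sym1[of u "u + 2 * v"] uv by simp
      from 1 2 3 4 5 show ?thesis by linarith
    qed
    then have "\<bar>(2 - 2 powr \<alpha>) * G u v - G 1 1 * (u powr \<alpha> + v powr \<alpha> - 1)\<bar> \<le> 3 * \<epsilon> + 6 * \<sigma>"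
      using homog[of 2 u v] diag[of u] diag[of v] uv by (simp add: algebra_simps)
    moreover have "(2 - 2 powr \<alpha>) * G u v - G 1 1 * (u powr \<alpha> + v powr \<alpha> - 1)
        = (2 - 2 powr \<alpha>) * (G u v - b * (u powr \<alpha> + v powr \<alpha> - 1))" (is "_ = _ * ?r")
      using two by (simp add: b_def field_simps)
    moreover have "\<bar>?r\<bar> \<le> \<bar>(2 - 2 powr \<alpha>) * ?r\<bar>"
      unfolding abs_mult using two mult_right_mono[of 1 "\<bar>2 - 2 powr \<alpha>\<bar>" "\<bar>?r\<bar>"] by simp
    ultimately show "\<bar>?r\<bar> \<le> 3 * \<epsilon> + 6 * \<sigma>" by linarith
  qed
qed

section \<open>The two cases of the stability theorem\<close>

theorem theorem2p1:
  fixes \<alpha> \<epsilon> :: real and f :: "real \<Rightarrow> real"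
  assumes "\<alpha> \<le> 0" and "\<epsilon> \<ge> 0"
    and "\<forall>(x, y)\<in>D_open.
      \<bar>f x + (1 - x) powr \<alpha> * f (y / (1 - x)) - f y - (1 - y) powr \<alpha> * f (x / (1 - y))\<bar> \<le> \<epsilon>"
  shows "(\<alpha> < 0 \<longrightarrow>
           (\<exists>a b :: real. \<forall>x\<in>{0<..<1}.
             \<bar>f x - (a * x powr \<alpha> + b * (1 - x) powr \<alpha> - b)\<bar> \<le> 15 * \<epsilon>)) \<and>
         (\<alpha> = 0 \<longrightarrow>
           (\<exists>(l :: real \<Rightarrow> real) (c :: real). logarithmic l \<and>
             (\<forall>x\<in>{0<..<1}. \<bar>f x - (l (1 - x) + c)\<bar> \<le> 63 * \<epsilon>)))"
proof -
  define F where "F = homogeneous_extension \<alpha> f"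
  have f: "F (1 - x) x = f x" for x
    by (simp add: F_def homogeneous_extension_def)
  have homog: "F (t * u) (t * v) = t powr \<alpha> * F u v" if "t > 0" "u > 0" "v > 0" for t u v
    unfolding F_def using that by (rule homogeneous_extension_scale)
  have defect: "\<bar>F z y + F (z + y) x - F z x - F (z + x) y\<bar> \<le> \<epsilon> * (x + y + z) powr \<alpha>"
    if "x > 0" "y > 0" "z > 0" for x y z
    unfolding F_def using assms(3) that by (rule homogeneous_extension_defect)
  define A where "A u v = F u v - F v u" for u v
  have cyc: "\<bar>A x y + A y z + A z x\<bar> \<le> 3 * \<epsilon> * (x + y + z) powr \<alpha>"
    if "x > 0" "y > 0" "z > 0" for x y z
    using almost_cyclic_antisymmetric_part[of F "\<lambda>s. \<epsilon> * s powr \<alpha>", OF defect that]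
    by (simp add: A_def)
  have homogA: "A (t * u) (t * v) = t powr \<alpha> * A u v" if "t > 0" "u > 0" "v > 0" for t u v
    using that by (simp add: A_def homog algebra_simps)
  show ?thesis
  proof (intro conjI impI)
    assume "\<alpha> < 0"
    then obtain c where c: "\<And>u v. u > 0 \<Longrightarrow> v > 0 \<Longrightarrow> A u v = c * (v powr \<alpha> - u powr \<alpha>)"
      using antisymmetric_part_powr[of \<alpha> A "3 * \<epsilon>", OF _ _ homogA cyc] by (auto simp: A_def)
    \<comment> \<open>The subtracted term solves the equation exactly and has antisymmetric part
      \<open>A\<close>, so \<open>G\<close> keeps the defect of \<open>F\<close> and is exactly
      symmetric.\<close>
    define G where "G u v = F u v - c * v powr \<alpha>" for u v
    obtain b where b: "\<And>u v. u > 0 \<Longrightarrow> v > 0 \<Longrightarrow> u + v = 1 \<Longrightarrow>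
        \<bar>G u v - b * (u powr \<alpha> + v powr \<alpha> - 1)\<bar> \<le> 3 * \<epsilon> + 6 * 0"
    proof (rule almost_symmetric_cocycle_bound[of \<alpha> G \<epsilon> 0])
      show "G (t * u) (t * v) = t powr \<alpha> * G u v" if "t > 0" "u > 0" "v > 0" for t u v
        using that by (simp add: G_def homog powr_mult algebra_simps)
      show "\<bar>G z y + G (z + y) x - G z x - G (z + x) y\<bar> \<le> \<epsilon> * (x + y + z) powr \<alpha>"
        if "x > 0" "y > 0" "z > 0" for x y z
        using defect[OF that] by (simp add: G_def)
      show "\<bar>G u v - G v u\<bar> \<le> 0 * (u + v) powr \<alpha>" if "u > 0" "v > 0" for u v
        using c[OF that] by (simp add: G_def A_def algebra_simps)
    qed (use assms in auto)
    show "\<exists>a b. \<forall>x\<in>{0<..<1}. \<bar>f x - (a * x powr \<alpha> + b * (1 - x) powr \<alpha> - b)\<bar> \<le> 15 * \<epsilon>"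
    proof (intro exI ballI)
      fix x :: real assume "x \<in> {0<..<1}"
      then have "\<bar>f x - ((b + c) * x powr \<alpha> + b * (1 - x) powr \<alpha> - b)\<bar> \<le> 3 * \<epsilon>"
        using b[of "1 - x" x] by (simp add: G_def f algebra_simps)
      then show "\<bar>f x - ((b + c) * x powr \<alpha> + b * (1 - x) powr \<alpha> - b)\<bar> \<le> 15 * \<epsilon>"
        using \<open>\<epsilon> \<ge> 0\<close> by linarith
    qed
  next
    assume "\<alpha> = 0"
    have hA: "A (t * u) (t * v) = A u v" if "t > 0" "u > 0" "v > 0" for t u v
      using homogA[OF that] that \<open>\<alpha> = 0\<close> by simp
    have "norm (A (x * y) 1 - A x 1 - A y 1) \<le> 3 * \<epsilon>" if "x > 0" "y > 0" for x y
    proof -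
      \<comment> \<open>Needed to simplify \<open>powr 0\<close> to 1, since
        \<open>0 powr 0 = 0\<close>.\<close>
      have "x * y + y + 1 \<noteq> 0" using that by (simp add: add_pos_pos less_imp_neq[symmetric])
      then show ?thesis
        using cyc[of "x * y" y 1] hA[of y x 1] that \<open>\<alpha> = 0\<close>
        by (simp add: A_def mult.commute)
    qed
    then obtain L where L: "\<And>x y. x > 0 \<Longrightarrow> y > 0 \<Longrightarrow> L (x * y) = L x + L y"
        and AL: "\<And>x. x > 0 \<Longrightarrow> norm (A x 1 - L x) \<le> 3 * \<epsilon>"
      by (rule Hyers_stability_logarithmic[of "\<lambda>x. A x 1" "3 * \<epsilon>"]) blast+
    have L1: "L 1 = 0" using L[of 1 1] by simp
    have Ldiv: "L (u / v) = L u - L v" if "u > 0" "v > 0" for u v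
      using L[of "u / v" v] that by simp
    \<comment> \<open>\<open>L u - L (u + v)\<close> is an exact solution with antisymmetric part
      \<open>L (u / v)\<close>, which lies within \<open>3 * \<epsilon>\<close> of
      \<open>A u v\<close>. Hence \<sigma> = \<open>3 * \<epsilon>\<close>, and the final error is
      \<open>21 * \<epsilon>\<close>.\<close>
    define G where "G u v = F u v - L u + L (u + v)" for u v
    obtain c where c: "\<And>u v. u > 0 \<Longrightarrow> v > 0 \<Longrightarrow> u + v = 1 \<Longrightarrow>
        \<bar>G u v - c * (u powr \<alpha> + v powr \<alpha> - 1)\<bar> \<le> 3 * \<epsilon> + 6 * (3 * \<epsilon>)"
    proof (rule almost_symmetric_cocycle_bound[of \<alpha> G \<epsilon> "3 * \<epsilon>"])
      show "G (t * u) (t * v) = t powr \<alpha> * G u v" if "t > 0" "u > 0" "v > 0" for t u v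
      proof -
        have "L (t * u + t * v) = L t + L (u + v)"
          using L[of t "u + v"] that by (simp add: algebra_simps)
        then show ?thesis
          using homog[OF that] L[of t u] that \<open>\<alpha> = 0\<close> by (simp add: G_def)
      qed
      show "\<bar>G z y + G (z + y) x - G z x - G (z + x) y\<bar> \<le> \<epsilon> * (x + y + z) powr \<alpha>"
        if "x > 0" "y > 0" "z > 0" for x y z
        using defect[OF that] by (simp add: G_def add_ac)
      show "\<bar>G u v - G v u\<bar> \<le> 3 * \<epsilon> * (u + v) powr \<alpha>" if "u > 0" "v > 0" for u v
        using AL[of "u / v"] hA[of v "u / v" 1] Ldiv[OF that] that \<open>\<alpha> = 0\<close>
        by (simp add: G_def A_def add.commute)
    qed (use assms in auto)
    show "\<exists>l c. logarithmic l \<and> (\<forall>x\<in>{0<..<1}. \<bar>f x - (l (1 - x) + c)\<bar> \<le> 63 * \<epsilon>)"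
    proof (intro exI conjI ballI)
      show "logarithmic L" by (simp add: logarithmic_def L)
      fix x :: real assume "x \<in> {0<..<1}"
      \<comment> \<open>On \<open>u + v = 1\<close> the term \<open>L (u + v)\<close> is
        \<open>L 1 = 0\<close>, and for \<alpha> = 0 the factor of \<open>c\<close> equals
        1.\<close>
      then have "\<bar>f x - (L (1 - x) + c)\<bar> \<le> 21 * \<epsilon>"
        using c[of "1 - x" x] \<open>\<alpha> = 0\<close> by (simp add: G_def f L1 algebra_simps)
      then show "\<bar>f x - (L (1 - x) + c)\<bar> \<le> 63 * \<epsilon>"
        using \<open>\<epsilon> \<ge> 0\<close> by linarith
    qed
  qed
qed

end
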